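(* Let $x,y,z\in\mathbb{R}$ with $x\geq y\geq z$, let $a,b,c\in\mathbb{R}$ with $a,c\geq 0$ and $a+c\geq |b|$, and let $g:\mathbb{R}\to\mathbb{R}$ be a function in class $\mathcal{G}$. Then $$a\,g(x-y)g(x-z) + b\,g(y-z)g(y-x) + c\,g(z-x)g(z-y) \geq 0.$$
   Context: A function $g:\mathbb{R}\to\mathbb{R}$ is in class $\mathcal{G}$ if $g$ is either even or odd, $g(0)\geq 0$, and $g$ is monotonically nondecreasing on $[0,\infty)$. *)

theory Defs
  imports Complex_Main
begin

definition class_G :: "(real \<Rightarrow> real) set" where
  "class_G = {g. ((\<forall>t. g (- t) = g t) \<or> (\<forall>t. g (- t) = - g t))
                 \<and> g 0 \<ge> 0 \<and> mono_on {0..} g}"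

end

theory Submission
  imports Defs
begin

text \<open>Put \<open>p = g (x - y)\<close>, \<open>q = g (y - z)\<close>,
  \<open>r = g (x - z)\<close>. Since x - z is the largest of the three nonnegative differences,
  monotonicity and \<open>0 \<le> g 0\<close> give 0 \<le> p, q \<le> r. Parity turns the sum into a
  p r \<plusminus> b p q + c r q. Replacing r by q in the first term and by p in the last only
  lowers it, to (a \<plusminus> b + c) p q, which is nonnegative because |b| \<le> a + c.
  \<open>weighted_products_nonneg\<close> is this estimate.\<close>

lemma weighted_products_nonneg:
  fixes a b c p q r :: real
  assumes "0 \<le> p" "0 \<le> q" "p \<le> r" "q \<le> r" "0 \<le> a" "0 \<le> c" "\<bar>b\<bar> \<le> a + c"
  shows "0 \<le> a * p * r + b * q * p + c * r * q"
proof -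
  have "a * p * q \<le> a * p * r" "c * p * q \<le> c * r * q"
    using assms by (simp_all add: mult_left_mono mult_right_mono)
  moreover have "0 \<le> (a + b + c) * (p * q)"
    using assms by (intro mult_nonneg_nonneg) auto
  ultimately show ?thesis by (simp add: algebra_simps)
qed

theorem theorem1:
  fixes x y z a b c :: real and g :: "real \<Rightarrow> real"
  assumes "x \<ge> y" and "y \<ge> z"
    and "a \<ge> 0" and "c \<ge> 0" and "a + c \<ge> \<bar>b\<bar>"
    and "g \<in> class_G"
  shows "a * g (x - y) * g (x - z) + b * g (y - z) * g (y - x) + c * g (z - x) * g (z - y) \<ge> 0"
proof -
  have parity: "(\<forall>t. g (- t) = g t) \<or> (\<forall>t. g (- t) = - g t)"
    and g0: "0 \<le> g 0" and mono: "mono_on {0..} g"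
    using assms(6) by (auto simp: class_G_def)
  have g_mono: "g s \<le> g t" if "0 \<le> s" "s \<le> t" for s t
    using mono_onD[OF mono, of s t] that by simp
  have "0 \<le> g (x - y)" "0 \<le> g (y - z)"
    using g0 g_mono[of 0] assms(1,2) by (meson diff_ge_0_iff_ge order.refl order_trans)+
  moreover have "g (x - y) \<le> g (x - z)" "g (y - z) \<le> g (x - z)"
    using assms(1,2) by (auto intro: g_mono)
  \<comment> \<open>The bound on b involves only its absolute value, so a middle coefficient
    \<open>d\<close> equal to b or -b serves both parities.\<close>
  ultimately have nonneg: "0 \<le> a * g (x - y) * g (x - z) + d * g (y - z) * g (x - y)
      + c * g (x - z) * g (y - z)" if "\<bar>d\<bar> = \<bar>b\<bar>" for d
    using weighted_products_nonneg[where b = d] assms(3-5) that by simp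
  from parity show ?thesis
  proof
    assume "\<forall>t. g (- t) = g t"
    then have "g (y - x) = g (x - y)" "g (z - x) = g (x - z)" "g (z - y) = g (y - z)"
      by (metis minus_diff_eq)+
    then show ?thesis using nonneg[of b] by simp
  next
    assume "\<forall>t. g (- t) = - g t"
    \<comment> \<open>The b term has one reversed argument and changes sign; the c term has two, and
      their signs cancel. Hence the instance \<open>- b\<close>.\<close>
    then have "g (y - x) = - g (x - y)" "g (z - x) = - g (x - z)" "g (z - y) = - g (y - z)"
      by (metis minus_diff_eq)+
    then show ?thesis using nonneg[of "- b"] by simp
  qed
qed

end
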